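(* The three-party AND protocol described in the context is perfectly secure: when the keys $K_a,K_b,K_2,K_5,K_6,K_7,K_8$ are independent uniformly random bits, none of the three parties (EVH, KH, helper) obtains any information about $a$ or $b$; that is, for each of the three parties the joint distribution of its view does not depend on $(a,b)\in\{0,1\}^2$.
   Context: For bits $m,K\in\{0,1\}$: $ENC_K(m):=K\oplus m$, where $\oplus$ is XOR and $\wedge$ is AND. Parties are semi-honest, communicate over perfectly secure channels, and do not collude. Three-party protocol for the AND of two secret bits $a,b$. Parties: a key holder (KH), an encrypted value holder (EVH), and one helper. Initially the EVH holds $ENC_{K_a}(a)$ and $ENC_{K_b}(b)$, and the KH holds $K_a$ and $K_b$. Keys are shared between parties as follows: $K_b$ between KH and helper; $K_2$ and $K_5$ between EVH and helper; $K_6$ and $K_8$ between EVH and KH; $K_7$ between KH and helper. - The EVH sends $ENC_{K_a}(a)$ to the helper and $ENC_{K_b\oplus K_2}(b)$ to the KH. - The KH sends $ENC_{K_6}(K_a)$ to the helper. - The helper sends $ENC_{K_5}(K_b\oplus K_2)$ to the KH. - The helper computes $t_4:=\big(ENC_{K_a}(a)\wedge (K_b\oplus K_2)\big)\oplus \big(ENC_{K_6}(K_a)\wedge (K_b\oplus K_2)\big)$ and sends $ENC_{K_7}(t_4)$ to the EVH. - The EVH computes locally the encrypted result $\big(ENC_{K_a}(a)\wedge ENC_{K_b\oplus K_2}(b)\big)\oplus (K_5\wedge K_6)\oplus ENC_{K_7}(t_4)\oplus K_8$, and the KH computes locally the final key $\big(K_a\wedge ENC_{K_b\oplus K_2}(b)\big)\oplus\big(K_6\wedge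 ENC_{K_5}(K_b\oplus K_2)\big)\oplus K_7\oplus K_8$. Views: - EVH: $\big(K_2,K_5,K_6,K_8,ENC_{K_a}(a),ENC_{K_b}(b),ENC_{K_7}(t_4)\big)$. - KH: $\big(K_a,K_b,K_6,K_7,K_8,ENC_{K_b\oplus K_2}(b),ENC_{K_5}(K_b\oplus K_2)\big)$. - Helper: $\big(K_b,K_2,K_5,K_7,ENC_{K_a}(a),ENC_{K_6}(K_a)\big)$. *)

theory Defs
  imports "HOL-Probability.Probability_Mass_Function" "HOL-Library.Monad_Syntax"
begin

abbreviation xor_bool :: "bool \<Rightarrow> bool \<Rightarrow> bool"  (infixl "\<oplus>" 65)
  where "x \<oplus> y \<equiv> (x \<noteq> y)"

definition enc :: "bool \<Rightarrow> bool \<Rightarrow> bool"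
  where "enc K m = K \<oplus> m"

record keys =
  Ka :: bool
  Kb :: bool
  K2 :: bool
  K5 :: bool
  K6 :: bool
  K7 :: bool
  K8 :: bool

definition random_keys :: "keys pmf"
  where "random_keys = do {
    ka \<leftarrow> pmf_of_set UNIV;
    kb \<leftarrow> pmf_of_set UNIV;
    k2 \<leftarrow> pmf_of_set UNIV;
    k5 \<leftarrow> pmf_of_set UNIV;
    k6 \<leftarrow> pmf_of_set UNIV;
    k7 \<leftarrow> pmf_of_set UNIV;
    k8 \<leftarrow> pmf_of_set UNIV;
    return_pmf \<lparr>Ka = ka, Kb = kb, K2 = k2, K5 = k5, K6 = k6, K7 = k7, K8 = k8\<rparr>
  }"

definition evh_to_helper :: "bool \<Rightarrow> bool \<Rightarrow> keys \<Rightarrow> bool"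
  where "evh_to_helper a b k = enc (Ka k) a"

text \<open>The EVH can form this message without knowing the bit or its key: it is
  \<^term>\<open>K2 k \<oplus> enc (Kb k) b\<close>.\<close>

definition evh_to_kh :: "bool \<Rightarrow> bool \<Rightarrow> keys \<Rightarrow> bool"
  where "evh_to_kh a b k = enc (Kb k \<oplus> K2 k) b"

definition kh_to_helper :: "bool \<Rightarrow> bool \<Rightarrow> keys \<Rightarrow> bool"
  where "kh_to_helper a b k = enc (K6 k) (Ka k)"

definition helper_to_kh :: "bool \<Rightarrow> bool \<Rightarrow> keys \<Rightarrow> bool"
  where "helper_to_kh a b k = enc (K5 k) (Kb k \<oplus> K2 k)"

definition t4 :: "bool \<Rightarrow> bool \<Rightarrow> keys \<Rightarrow> bool"
  where "t4 a b k =
    (evh_to_helper a b k \<and> (Kb k \<oplus> K2 k)) \<oplus> (kh_to_helper a b k \<and> (Kb k \<oplus> K2 k))"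

definition helper_to_evh :: "bool \<Rightarrow> bool \<Rightarrow> keys \<Rightarrow> bool"
  where "helper_to_evh a b k = enc (K7 k) (t4 a b k)"

definition evh_result :: "bool \<Rightarrow> bool \<Rightarrow> keys \<Rightarrow> bool"
  where "evh_result a b k =
    (evh_to_helper a b k \<and> evh_to_kh a b k) \<oplus> (K5 k \<and> K6 k) \<oplus> helper_to_evh a b k \<oplus> K8 k"

definition kh_final_key :: "bool \<Rightarrow> bool \<Rightarrow> keys \<Rightarrow> bool"
  where "kh_final_key a b k =
    (Ka k \<and> evh_to_kh a b k) \<oplus> (K6 k \<and> helper_to_kh a b k) \<oplus> K7 k \<oplus> K8 k"

lemma evh_result_eq: "evh_result a b k = enc (kh_final_key a b k) (a \<and> b)"
  by (auto simp: evh_result_def kh_final_key_def helper_to_evh_def t4_def helper_to_kh_def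
      kh_to_helper_def evh_to_kh_def evh_to_helper_def enc_def)

definition evh_view ::
    "bool \<Rightarrow> bool \<Rightarrow> keys \<Rightarrow> bool \<times> bool \<times> bool \<times> bool \<times> bool \<times> bool \<times> bool"
  where "evh_view a b k =
    (K2 k, K5 k, K6 k, K8 k, enc (Ka k) a, enc (Kb k) b, helper_to_evh a b k)"

definition kh_view ::
    "bool \<Rightarrow> bool \<Rightarrow> keys \<Rightarrow> bool \<times> bool \<times> bool \<times> bool \<times> bool \<times> bool \<times> bool"
  where "kh_view a b k =
    (Ka k, Kb k, K6 k, K7 k, K8 k, evh_to_kh a b k, helper_to_kh a b k)"

definition helper_view ::
    "bool \<Rightarrow> bool \<Rightarrow> keys \<Rightarrow> bool \<times> bool \<times> bool \<times> bool \<times> bool \<times> bool"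
  where "helper_view a b k =
    (Kb k, K2 k, K5 k, K7 k, evh_to_helper a b k, kh_to_helper a b k)"

definition view_independent_of_inputs :: "(bool \<Rightarrow> bool \<Rightarrow> keys \<Rightarrow> 'v) \<Rightarrow> bool"
  where "view_independent_of_inputs view \<longleftrightarrow>
    (\<forall>a b a' b'. map_pmf (view a b) random_keys = map_pmf (view a' b') random_keys)"

end

(* For each party and each pair of inputs, replace in the key tuple the keys unknown to that party
   by the messages they mask. This is a permutation of the key tuples, hence preserves their uniform
   distribution, and the view is a function of the permuted tuple that does not involve the
   inputs. *)

theory Submission
  imports Defs
begin

lemma pmf_random_keys: "pmf random_keys k = 1 / 128"
proof (cases k)
  case (fields ka kb k2 k5 k6 k7 k8)
  \<comment> \<open>A product nested to the right in the order of sampling lets each sum over a bit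
    pull out the factors of earlier bits. What remains sums to 1, so each of the seven draws
    contributes 1/2.\<close>
  have "indicator {k} l = (of_bool (Ka l = ka) * (of_bool (Kb l = kb) * (of_bool (K2 l = k2) *
    (of_bool (K5 l = k5) * (of_bool (K6 l = k6) * (of_bool (K7 l = k7) * of_bool (K8 l = k8)))))) :: real)"
    for l
    by (cases l) (auto simp: fields)
  then show ?thesis
    by (simp add: random_keys_def pmf_bind_pmf_of_set flip: sum_distrib_left sum_divide_distrib)
qed

lemma finite_keys: "finite (UNIV :: keys set)"
proof (rule finite_imageD)
  show "inj (\<lambda>k::keys. (Ka k, Kb k, K2 k, K5 k, K6 k, K7 k, K8 k))"
    by (auto intro!: injI keys.equality)
qed simp

text \<open>On the finite type \<open>keys\<close> an injection is a permutation, and all keys have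
  equal mass.\<close>

lemma map_pmf_inj_random_keys:
  assumes "inj f"
  shows "map_pmf f random_keys = random_keys"
proof (rule pmf_eqI)
  fix k
  obtain l where "k = f l"
    using finite_UNIV_inj_surj[OF finite_keys assms] by (metis surjD)
  then show "pmf (map_pmf f random_keys) k = pmf random_keys k"
    by (simp add: pmf_map_inj' assms pmf_random_keys)
qed

text \<open>Since \<open>g\<close> is the same for all inputs, every view has the distribution
  \<open>map_pmf g random_keys\<close>.\<close>

lemma view_independent_of_inputsI:
  fixes \<phi> :: "bool \<Rightarrow> bool \<Rightarrow> keys \<Rightarrow> keys"
  assumes inj: "\<And>a b. inj (\<phi> a b)"
    and factor: "\<And>a b k. view a b k = g (\<phi> a b k)"
  shows "view_independent_of_inputs view"
proof -
  have "map_pmf (view a b) random_keys = map_pmf g random_keys" for a b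
  proof -
    have "view a b = g \<circ> \<phi> a b"
      by (auto simp: factor)
    then show ?thesis
      by (simp add: map_pmf_inj_random_keys[OF inj] flip: pmf.map_comp)
  qed
  then show ?thesis
    by (simp add: view_independent_of_inputs_def)
qed

theorem theorem4:
  shows "view_independent_of_inputs evh_view \<and>
    view_independent_of_inputs kh_view \<and>
    view_independent_of_inputs helper_view"
proof (intro conjI)
  \<comment> \<open>To invert: \<open>K2\<close> and \<open>K6\<close> are kept, \<open>Ka\<close>
    and \<open>Kb\<close> follow by removing \<open>a\<close> and \<open>b\<close>. These four keys
    determine \<open>t4\<close>, which does not involve \<open>K7\<close>, so \<open>K7\<close>
    follows too.\<close>
  let ?evh = "\<lambda>a b k. k\<lparr>Ka := enc (Ka k) a, Kb := enc (Kb k) b, K7 := helper_to_evh a b k\<rparr>"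
  show "view_independent_of_inputs evh_view"
  proof (rule view_independent_of_inputsI)
    show "inj (?evh a b)" for a b
    proof (rule injI)
      fix k l
      assume "?evh a b k = ?evh a b l"
      then show "k = l"
        by (cases k; cases l) (auto simp: helper_to_evh_def t4_def evh_to_helper_def
          kh_to_helper_def enc_def)
    qed
    show "evh_view a b k = (\<lambda>l. (K2 l, K5 l, K6 l, K8 l, Ka l, Kb l, K7 l)) (?evh a b k)" for a b k
      by (simp add: evh_view_def)
  qed
  \<comment> \<open>The kept \<open>Kb\<close> together with \<open>b\<close> gives back
    \<open>K2\<close>; then \<open>Kb k \<oplus> K2 k\<close> is known and unmasks
    \<open>K5\<close>.\<close>
  let ?kh = "\<lambda>a b k. k\<lparr>K2 := evh_to_kh a b k, K5 := helper_to_kh a b k\<rparr>"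
  show "view_independent_of_inputs kh_view"
  proof (rule view_independent_of_inputsI)
    show "inj (?kh a b)" for a b
    proof (rule injI)
      fix k l
      assume "?kh a b k = ?kh a b l"
      then show "k = l"
        by (cases k; cases l) (auto simp: evh_to_kh_def helper_to_kh_def enc_def)
    qed
    show "kh_view a b k = (\<lambda>l. (Ka l, Kb l, K6 l, K7 l, K8 l, K2 l, K5 l)) (?kh a b k)" for a b k
      by (simp add: kh_view_def)
  qed
  \<comment> \<open>Here \<open>a\<close> gives back \<open>Ka\<close>, which in turn gives back
    \<open>K6\<close>.\<close>
  let ?helper = "\<lambda>a b k. k\<lparr>Ka := evh_to_helper a b k, K6 := kh_to_helper a b k\<rparr>"
  show "view_independent_of_inputs helper_view"
  proof (rule view_independent_of_inputsI)
    show "inj (?helper a b)" for a b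
    proof (rule injI)
      fix k l
      assume "?helper a b k = ?helper a b l"
      then show "k = l"
        by (cases k; cases l) (auto simp: evh_to_helper_def kh_to_helper_def enc_def)
    qed
    show "helper_view a b k = (\<lambda>l. (Kb l, K2 l, K5 l, K7 l, Ka l, K6 l)) (?helper a b k)" for a b k
      by (simp add: helper_view_def)
  qed
qed

end
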